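(* Let $t_n=(-1)^{s_2(n)}$, $h_0=0$, $h_1=1$, and $h_n=t_nh_{n-1}+h_{n-2}$ for $n\ge2$. For every $k\in\mathbb{N}$, $$h_{2^{2k+1}-1}^2+h_{2^{2k+1}+1}^2=h_{2^{2k+1}-2}^2+h_{2^{2k+1}-1}^2=h_{2^{2k+2}-3}.$$
   Context: $s_2(n)$ denotes the number of 1's in the binary expansion of $n$; $(t_n)$ is the Prouhet–Thue–Morse sequence. *)

theory Defs
  imports Main
begin

definition s2 :: "nat \<Rightarrow> nat" where
  "s2 n = card {i. bit n i}"

definition t :: "nat \<Rightarrow> int" where
  "t n = (- 1) ^ s2 n"

fun h :: "nat \<Rightarrow> int" where
  "h 0 = 0"
| "h (Suc 0) = 1"
| "h (Suc (Suc n)) = t (Suc (Suc n)) * h (Suc n) + h n"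

end

theory Submission
  imports Defs
begin

text \<open>
  Let \<open>P\<^sub>m\<close> be the product of the matrices \<open>[[t\<^sub>n, 1], [1, 0]]\<close> over \<open>n < 2^m\<close>, in decreasing
  order of \<open>n\<close>, and let \<open>D = diag(1, -1)\<close>.  Negating every \<open>t\<^sub>n\<close> replaces \<open>P\<^sub>m\<close> by \<open>D P\<^sub>m D\<close>
  when \<open>m \<ge> 1\<close>, so the self-similarity of the Thue--Morse sequence gives
  \<open>P\<^sub>m\<^sub>+\<^sub>1 = D P\<^sub>m D P\<^sub>m\<close>.  By induction the transpose of \<open>P\<^sub>m\<close> is \<open>P\<^sub>m\<close> for even \<open>m\<close> and
  \<open>D P\<^sub>m D\<close> for odd \<open>m\<close>.  For odd \<open>m\<close> this reads \<open>P\<^sub>m = [[a, b], [-b, d]]\<close> and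
  \<open>P\<^sub>m\<^sub>+\<^sub>1 = P\<^sub>m\<^sup>T P\<^sub>m\<close>, and both identities become polynomial identities in \<open>a, b, d\<close>.
\<close>

lemma finite_bits_nat: "finite {i. bit (n :: nat) i}"
proof (rule finite_subset)
  show "{i. bit n i} \<subseteq> {..n}"
  proof
    fix i assume "i \<in> {i. bit n i}"
    then have "n div 2 ^ i \<noteq> 0"
      by (auto simp: bit_iff_odd intro: odd_pos)
    then have "2 ^ i \<le> n"
      by (metis div_less not_less)
    then show "i \<in> {..n}"
      using less_exp[of i] by (simp del: less_exp)
  qed
qed simp

lemma s2_double: "s2 (2 * n) = s2 n"
proof -
  have "{i. bit (2 * n) i} = Suc ` {i. bit n i}"
    by (auto simp: bit_double_iff image_iff gr0_conv_Suc)
  then show ?thesis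
    by (simp add: s2_def card_image)
qed

lemma s2_double_Suc: "s2 (Suc (2 * n)) = Suc (s2 n)"
proof -
  have "{i. bit (Suc (2 * n)) i} = insert 0 (Suc ` {i. bit n i})"
  proof (rule set_eqI)
    fix i show "i \<in> {i. bit (Suc (2 * n)) i} \<longleftrightarrow> i \<in> insert 0 (Suc ` {i. bit n i})"
      by (cases i) (auto simp: bit_0 bit_Suc)
  qed
  then show ?thesis
    by (simp add: s2_def card_image finite_bits_nat)
qed

lemma t_double: "t (2 * n) = t n"
  by (simp add: t_def s2_double)

lemma t_double_Suc: "t (Suc (2 * n)) = - t n"
  by (simp add: t_def s2_double_Suc)

lemma t_0: "t 0 = 1"
  by (simp add: t_def s2_def)

lemma t_sq: "t n * t n = 1"
  by (simp add: t_def flip: power_add mult_2)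

lemma t_power2: "t (2 ^ m) = - 1"
  using t_double_Suc[of 0] by (induction m) (simp_all add: t_0 t_double)

lemma t_power2_minus_1: "t (2 ^ m - 1) = (- 1) ^ m"
proof (induction m)
  case (Suc m)
  have "(2 :: nat) ^ Suc m - 1 = Suc (2 * (2 ^ m - 1))"
    using one_le_power[of "2 :: nat" m] unfolding power_Suc by linarith
  then show ?case
    using Suc by (simp add: t_double_Suc del: power_Suc) simp
qed (simp add: t_0)

text \<open>
  The matrix \<open>[[a, b], [c, d]]\<close> is \<open>P\<^sub>m\<close>; the block with index \<open>j\<close> acts by \<open>P\<^sub>m\<close> or \<open>D P\<^sub>m D\<close>
  according to the sign \<open>t j\<close>.
\<close>
definition block_matrix :: "nat \<Rightarrow> (nat \<Rightarrow> int) \<Rightarrow> int \<Rightarrow> int \<Rightarrow> int \<Rightarrow> int \<Rightarrow> bool" where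
  "block_matrix m x a b c d \<longleftrightarrow>
    (\<forall>j. x (2 ^ m * Suc j + 1) = a * x (2 ^ m * j + 1) + t j * b * x (2 ^ m * j) \<and>
         x (2 ^ m * Suc j) = t j * c * x (2 ^ m * j + 1) + d * x (2 ^ m * j))"

text \<open>Block \<open>j\<close> of level \<open>Suc m\<close> is block \<open>2 * j\<close>
  followed by block \<open>Suc (2 * j)\<close>, of signs \<open>t j\<close> and
  \<open>- t j\<close>; hence the entries of \<open>D P D P\<close>.\<close>

lemma block_matrix_Suc:
  assumes "block_matrix m x a b c d"
  shows "block_matrix (Suc m) x (a * a - b * c) (b * (a - d)) (- c * (a - d)) (d * d - b * c)"
  unfolding block_matrix_def
proof (intro allI)
  fix j
  define u where "u = x (2 ^ Suc m * j + 1)"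
  define v where "v = x (2 ^ Suc m * j)"
  define e where "e = t j"
  have ee: "e * (e * y) = y" for y
    unfolding e_def by (simp add: t_sq flip: mult.assoc)
  have idx: "2 ^ m * (2 * j) = 2 ^ Suc m * j" "2 ^ m * Suc (Suc (2 * j)) = 2 ^ Suc m * Suc j"
    by simp_all
  have 1: "x (2 ^ m * Suc (2 * j) + 1) = a * u + e * b * v"
    "x (2 ^ m * Suc (2 * j)) = e * c * u + d * v"
    using assms[unfolded block_matrix_def, rule_format, of "2 * j"]
    unfolding idx t_double u_def v_def e_def by auto
  have 2: "x (2 ^ Suc m * Suc j + 1) = a * (a * u + e * b * v) - e * b * (e * c * u + d * v)"
    "x (2 ^ Suc m * Suc j) = - e * c * (a * u + e * b * v) + d * (e * c * u + d * v)"
    using assms[unfolded block_matrix_def, rule_format, of "Suc (2 * j)"]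
    unfolding idx t_double_Suc 1 e_def by auto
  show "x (2 ^ Suc m * Suc j + 1) = (a * a - b * c) * x (2 ^ Suc m * j + 1)
            + t j * (b * (a - d)) * x (2 ^ Suc m * j) \<and>
        x (2 ^ Suc m * Suc j) = t j * (- c * (a - d)) * x (2 ^ Suc m * j + 1)
            + (d * d - b * c) * x (2 ^ Suc m * j)"
    unfolding 2 u_def[symmetric] v_def[symmetric] e_def[symmetric]
    by (simp add: algebra_simps ee)
qed

text \<open>Doubling scales \<open>b\<close> by \<open>a - d\<close> and \<open>c\<close> by
  \<open>- (a - d)\<close>, so their relative sign flips. The start is level 1: negating
  \<open>t n\<close> in a single step is not conjugation by \<open>D\<close>.\<close>

lemma block_matrix_exists:
  assumes rec: "\<And>n. x (n + 2) = t n * x (n + 1) + x n"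
  shows "\<exists>a b d. block_matrix (Suc m) x a b ((- 1) ^ Suc m * b) d"
proof (induction m)
  case 0
  have "block_matrix (Suc 0) x 0 (- 1) 1 1"
    unfolding block_matrix_def
  proof (intro allI)
    fix j
    have 1: "x (2 * j + 2) = t j * x (2 * j + 1) + x (2 * j)"
      using rec[of "2 * j"] by (simp add: t_double)
    have "x (2 * j + 3) = - t j * x (2 * j + 2) + x (2 * j + 1)"
      using rec[of "Suc (2 * j)"] by (simp add: t_double_Suc numeral_3_eq_3)
    also have "\<dots> = - t j * x (2 * j)"
      unfolding 1 by (simp add: algebra_simps t_sq flip: mult.assoc)
    finally have 2: "x (2 * j + 3) = - t j * x (2 * j)" .
    show "x (2 ^ Suc 0 * Suc j + 1) = 0 * x (2 ^ Suc 0 * j + 1) + t j * - 1 * x (2 ^ Suc 0 * j) \<and>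
          x (2 ^ Suc 0 * Suc j) = t j * 1 * x (2 ^ Suc 0 * j + 1) + 1 * x (2 ^ Suc 0 * j)"
      using 1 2 by (simp add: numeral_3_eq_3)
  qed
  then show ?case
    by (intro exI[of _ 0] exI[of _ "-1"] exI[of _ 1]) simp
next
  case (Suc m)
  then obtain a b d where "block_matrix (Suc m) x a b ((- 1) ^ Suc m * b) d"
    by blast
  from block_matrix_Suc[OF this] show ?case
    by (intro exI) (simp add: mult.assoc)
qed

theorem theorem4:
  fixes k :: nat
  shows "(h (2 ^ (2 * k + 1) - 1))\<^sup>2 + (h (2 ^ (2 * k + 1) + 1))\<^sup>2
           = (h (2 ^ (2 * k + 1) - 2))\<^sup>2 + (h (2 ^ (2 * k + 1) - 1))\<^sup>2
       \<and> (h (2 ^ (2 * k + 1) - 2))\<^sup>2 + (h (2 ^ (2 * k + 1) - 1))\<^sup>2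
           = h (2 ^ (2 * k + 2) - 3)"
proof -
  define m where "m = 2 * k + 1"
  \<comment> \<open>\<open>h\<close> extended backwards by \<open>h\<^sub>-\<^sub>1 = 1\<close> and \<open>h\<^sub>-\<^sub>2 = -1\<close>, so that the blocks start at \<open>t\<^sub>0\<close>.\<close>
  define x where "x n = (if n = 0 then - 1 else if n = 1 then 1 else h (n - 2))" for n
  have rec: "x (n + 2) = t n * x (n + 1) + x n" for n
  proof (cases n rule: h.cases)
    case 2
    then show ?thesis using t_power2[of 0] by (simp add: x_def)
  qed (simp_all add: x_def t_0)
  obtain a b d where "block_matrix m x a b ((- 1) ^ m * b) d"
    using block_matrix_exists[of x "2 * k", OF rec] by (auto simp: m_def)
  then have P: "block_matrix m x a b (- b) d"
    by (simp add: m_def)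
  have start: "x 0 = - 1" "x 1 = 1"
    by (simp_all add: x_def)
  have N: "2 ^ m \<ge> (2 :: nat)"
    by (simp add: m_def)
  have N': "2 ^ Suc m \<ge> (4 :: nat)"
    using N by simp
  have h_x: "h n = x (n + 2)" for n
    by (simp add: x_def)
  have h1: "h (2 ^ m - 1) = a - b"
    using P[unfolded block_matrix_def, rule_format, of 0] N start
    by (simp add: h_x t_0)
  have h2: "h (2 ^ m - 2) = - b - d"
    using P[unfolded block_matrix_def, rule_format, of 0] start le_add_diff_inverse2[OF N]
    by (simp only: h_x) (simp add: t_0)
  \<comment> \<open>With signs -1 and 1 at \<open>2 ^ m\<close> and \<open>2 ^ m + 1\<close>, two
    steps of the recurrence cancel \<open>h (2 ^ m - 1)\<close>.\<close>
  have h3: "h (2 ^ m + 1) = - b - d"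
  proof -
    obtain n where n: "2 ^ m = Suc (Suc n)"
      using N by (metis add_2_eq_Suc le_Suc_ex)
    obtain i where i: "m = Suc i"
      by (simp add: m_def)
    have "t (Suc (2 ^ m)) = 1"
      by (simp add: i t_double_Suc t_power2)
    moreover have "t (2 ^ m) = - 1"
      by (rule t_power2)
    ultimately have "h (2 ^ m + 1) = h n"
      by (simp add: n)
    then show ?thesis
      using h2 by (simp add: n)
  qed
  have h4: "h (2 ^ Suc m - 3) = (a - b)\<^sup>2 + (b + d)\<^sup>2"
  proof -
    have "x (2 ^ Suc m + 1) = (a * a + b * b) - b * (a - d)"
      "x (2 ^ Suc m) = b * (a - d) - (d * d + b * b)"
      using block_matrix_Suc[OF P, unfolded block_matrix_def, rule_format, of 0] start
      by (simp_all add: t_0)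
    \<comment> \<open>The target index lies one before the block end; the last step, of sign 1 as
      \<open>Suc m\<close> is even, is undone.\<close>
    moreover have "x (2 ^ Suc m + 1) = x (2 ^ Suc m) + x (2 ^ Suc m - 1)"
    proof -
      have "x (2 ^ Suc m - 1 + 2) = t (2 ^ Suc m - 1) * x (2 ^ Suc m - 1 + 1) + x (2 ^ Suc m - 1)"
        by (rule rec)
      moreover have "(2 :: nat) ^ Suc m - 1 + 2 = 2 ^ Suc m + 1" "(2 :: nat) ^ Suc m - 1 + 1 = 2 ^ Suc m"
        using N' by linarith+
      moreover have "t (2 ^ Suc m - 1) = 1"
        unfolding t_power2_minus_1 by (simp add: m_def)
      ultimately show ?thesis
        by simp
    qed
    moreover have "h (2 ^ Suc m - 3) = x (2 ^ Suc m - 1)"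
    proof -
      have "(2 :: nat) ^ Suc m - 3 + 2 = 2 ^ Suc m - 1"
        using N' by linarith
      then show ?thesis
        by (simp only: h_x)
    qed
    ultimately show ?thesis
      by (simp add: power2_eq_square algebra_simps)
  qed
  have m_Suc: "2 * k + 2 = Suc m"
    by (simp add: m_def)
  show ?thesis
    unfolding m_def[symmetric] m_Suc h1 h2 h3 h4
    by (simp add: power2_eq_square algebra_simps)
qed

end
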